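(* There is a $2$-ordering system $\preceq$ on $\omega_1$ whose order type is bounded by $(\omega_1,\omega)$ (i.e. $\mathrm{otp}(\preceq_\emptyset)\leq\omega_1$ and $\mathrm{otp}(\preceq_{\{x\}})\leq\omega$ for every $x\in\omega_1$) such that every closed $2$-initial segment for $\preceq$ is $\preceq$-closed. In particular, $\preceq$ has finite closures.
   Context: For $0<n<\omega$, an $n$-ordering system on a set $X$ is a function assigning to each $s\in[X]^{<n}$ (finite subsets of $X$ of size $<n$) a relation $\preceq_s\subseteq X^2$, defined recursively: a $1$-ordering system is one in which $\preceq_\emptyset$ is a (non-strict) well-order of $X$; for $n>1$, $\preceq$ is an $n$-ordering system if $\preceq_\emptyset$ is a non-strict well-order of $X$ and for every $x_0\in X$ the function $\preceq^{x_0}$ defined on $[X_{\prec_\emptyset x_0}]^{<n-1}$ by $\preceq^{x_0}_t=\preceq_{t\cup\{x_0\}}$ is an $(n-1)$-ordering system on $X_{\prec_\emptyset x_0}=\{x\in X: x\prec_\emptyset x_0\}$. Here $\prec_s$ denotes $\preceq_s$ minus the diagonal, and $\mathrm{dom}(\preceq_s)=\{x\in X:(x,x)\in\preceq_s\}$. A set $S\subseteq X$ is $\preceq$-closed if for every $s\subseteq S$ with $|s|=n-1$ and all $a,b\in\mathrm{dom}(\preceq_s)$, if $b\in S$ and $a\prec_s b$ then $a\in S$. For a $2$-ordering system, the closed $2$-initial segment determined by $\{x,b\}$ (with $b\in\mathrm{dom}(\preceq_{\{x\}})$) is $\{x,b\}\cup\{a: a\prec_{\{x\}} b\}$. The system has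 finite closures if every finite $A\subseteq X$ is contained in a finite $\preceq$-closed set. *)

theory Defs
  imports Main
begin

unbundle cardinal_syntax

text \<open>
  A family \<open>R\<close> assigning a relation to every finite subset of \<open>X\<close> with fewer than \<open>n\<close> elements
  is a total function on sets; its values elsewhere are irrelevant.
  Every \<open>s \<subseteq> X\<close> with \<open>0 < card s < n\<close> is \<open>insert x0 t\<close> with \<open>x0\<close> its \<open>R {}\<close>-largest element
  and \<open>t\<close> contained in the set of strict predecessors of \<open>x0\<close>.
\<close>

fun ordering_system :: "nat \<Rightarrow> 'a set \<Rightarrow> ('a set \<Rightarrow> 'a rel) \<Rightarrow> bool" where
  "ordering_system 0 X R \<longleftrightarrow> False"
| "ordering_system (Suc 0) X R \<longleftrightarrow> well_order_on X (R {})"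
| "ordering_system (Suc (Suc n)) X R \<longleftrightarrow>
     well_order_on X (R {}) \<and>
     (\<forall>x0\<in>X. ordering_system (Suc n) {x\<in>X. (x, x0) \<in> R {} - Id} (\<lambda>t. R (insert x0 t)))"

definition rel_dom :: "'a set \<Rightarrow> 'a rel \<Rightarrow> 'a set" where
  "rel_dom X r = {x\<in>X. (x, x) \<in> r}"

text \<open>Finiteness of \<open>s\<close> is needed because infinite sets have \<open>card\<close> equal to 0.\<close>

definition os_closed :: "nat \<Rightarrow> 'a set \<Rightarrow> ('a set \<Rightarrow> 'a rel) \<Rightarrow> 'a set \<Rightarrow> bool" where
  "os_closed n X R S \<longleftrightarrow> S \<subseteq> X \<and>
     (\<forall>s. s \<subseteq> S \<and> finite s \<and> card s = n - 1 \<longrightarrow>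
        (\<forall>a\<in>rel_dom X (R s). \<forall>b\<in>rel_dom X (R s). b \<in> S \<and> (a, b) \<in> R s - Id \<longrightarrow> a \<in> S))"

definition closed_initial_segment2 :: "'a set \<Rightarrow> ('a set \<Rightarrow> 'a rel) \<Rightarrow> 'a set \<Rightarrow> bool" where
  "closed_initial_segment2 X R S \<longleftrightarrow>
     (\<exists>x\<in>X. \<exists>b\<in>rel_dom X (R {x}). S = {x, b} \<union> {a. (a, b) \<in> R {x} - Id})"

definition finite_closures :: "nat \<Rightarrow> 'a set \<Rightarrow> ('a set \<Rightarrow> 'a rel) \<Rightarrow> bool" where
  "finite_closures n X R \<longleftrightarrow>
     (\<forall>A. finite A \<and> A \<subseteq> X \<longrightarrow> (\<exists>S. finite S \<and> os_closed n X R S \<and> A \<subseteq> S))"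

text \<open>
  The least well-order of cardinality greater than \<^const>\<open>natLeq\<close>, as a non-strict relation;
  the ordinal \<open>\<omega>\<^sub>1\<close> itself is its \<^const>\<open>Field\<close>.
\<close>

definition omega1 :: "nat set rel" where
  "omega1 = cardSuc natLeq"

text \<open>For well-orders, \<open>r \<le>o r'\<close> says that the order type of \<open>r\<close> is at most that of \<open>r'\<close>.\<close>

definition order_type_bounded2 ::
  "'a set \<Rightarrow> ('a set \<Rightarrow> 'a rel) \<Rightarrow> 'b rel \<Rightarrow> 'c rel \<Rightarrow> bool" where
  "order_type_bounded2 X R r0 r1 \<longleftrightarrow> R {} \<le>o r0 \<and> (\<forall>x\<in>X. R {x} \<le>o r1)"

end

theory Submission
  imports Defs "HOL-Library.Countable_Set"
begin

text \<open>
  The orders \<open>\<preceq>\<^bsub>{x}\<^esub>\<close> are built by recursion on \<open>x\<close> and are given by injections \<open>e x\<close> of the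
  predecessors of \<open>x\<close> into \<open>\<nat>\<close>. Suppose that, for all \<open>y < x\<close>, the initial segments of \<open>\<preceq>\<^bsub>{y}\<^esub>\<close>
  are closed. Then \<open>y\<close> together with an initial segment of \<open>\<preceq>\<^bsub>{y}\<^esub>\<close> is closed too, so every finite
  set of predecessors of \<open>x\<close> has a finite closed superset. Moreover, if \<open>F \<subset> G\<close> are finite closed
  sets, one point can be removed from \<open>G - F\<close> keeping \<open>G\<close> closed: the maximum \<open>m\<close> of \<open>G\<close> if it is
  not in \<open>F\<close>, and otherwise the \<open>\<preceq>\<^bsub>{m}\<^esub>\<close>-last element of \<open>G - {m}\<close>. Hence the countably many
  predecessors of \<open>x\<close> can be enumerated one point at a time through closed sets, and this
  enumeration is \<open>\<preceq>\<^bsub>{x}\<^esub>\<close>.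
\<close>

text \<open>This is \<open>os_closed\<close> for n = 2 when the order at y is given on
  \<open>underS r y\<close> by comparing values of \<open>e y\<close>.\<close>

definition rank_closed :: "'a rel \<Rightarrow> ('a \<Rightarrow> 'a \<Rightarrow> nat) \<Rightarrow> 'a set \<Rightarrow> bool" where
  "rank_closed r e S \<longleftrightarrow>
     (\<forall>y\<in>S. \<forall>c\<in>S \<inter> underS r y. \<forall>a\<in>underS r y. e y a < e y c \<longrightarrow> a \<in> S)"

text \<open>The candidate \<open>f\<close> for \<open>e x\<close> is separate from \<open>e\<close>:
  the condition uses \<open>e\<close> only strictly below \<open>x\<close>, so it can drive a
  recursion.\<close>

definition good_rank :: "'a rel \<Rightarrow> ('a \<Rightarrow> 'a \<Rightarrow> nat) \<Rightarrow> 'a \<Rightarrow> ('a \<Rightarrow> nat) \<Rightarrow> bool" where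
  "good_rank r e x f \<longleftrightarrow> inj_on f (underS r x) \<and>
     (\<forall>b\<in>underS r x. rank_closed r e {a\<in>underS r x. f a \<le> f b})"

text \<open>Lists record the order in which points are added. Large \<open>n\<close> gives the whole
  list, so \<open>set xs\<close> itself is closed.\<close>

definition closed_prefixes :: "'a rel \<Rightarrow> ('a \<Rightarrow> 'a \<Rightarrow> nat) \<Rightarrow> 'a list \<Rightarrow> bool" where
  "closed_prefixes r e xs \<longleftrightarrow> (\<forall>n. rank_closed r e (set (take n xs)))"

lemma rank_closedD:
  "\<lbrakk>rank_closed r e S; y \<in> S; c \<in> S; c \<in> underS r y; a \<in> underS r y; e y a < e y c\<rbrakk> \<Longrightarrow> a \<in> S"
  unfolding rank_closed_def by blast

lemma good_rank_cong:
  assumes "\<And>z. z \<in> underS r x \<Longrightarrow> e z = e' z"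
  shows "good_rank r e x f \<longleftrightarrow> good_rank r e' x f"
  using assms unfolding good_rank_def rank_closed_def by simp

lemma finite_obtain_max:
  fixes f :: "'a \<Rightarrow> 'b::linorder"
  assumes "finite A" "A \<noteq> {}"
  obtains b where "b \<in> A" "\<And>a. a \<in> A \<Longrightarrow> f a \<le> f b"
proof -
  have "Max (f ` A) \<in> f ` A" using assms by simp
  then obtain b where "b \<in> A" "f b = Max (f ` A)" by force
  then show thesis using that assms by simp
qed

lemma closed_prefixes_snoc:
  assumes "closed_prefixes r e xs" "rank_closed r e (set (xs @ [a]))"
  shows "closed_prefixes r e (xs @ [a])"
  unfolding closed_prefixes_def
proof
  fix n
  show "rank_closed r e (set (take n (xs @ [a])))"
    using assms by (cases "n \<le> length xs") (auto simp: closed_prefixes_def)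
qed

text \<open>\<open>I\<close> is the part already ranked: the predecessors of a point during the
  recursion, the whole field of \<open>omega1\<close> in the final proof.\<close>

locale ranking =
  fixes r :: "'a rel" and e :: "'a \<Rightarrow> 'a \<Rightarrow> nat" and I :: "'a set"
  assumes wo: "Well_order r"
    and I_Field: "I \<subseteq> Field r"
    and good: "\<And>x. x \<in> I \<Longrightarrow> good_rank r e x (e x)"
begin

section \<open>Finite closed sets\<close>

lemma inj_rank: "x \<in> I \<Longrightarrow> inj_on (e x) (underS r x)"
  using good by (auto simp: good_rank_def)

lemma closed_segment:
  "x \<in> I \<Longrightarrow> b \<in> underS r x \<Longrightarrow> rank_closed r e {a\<in>underS r x. e x a \<le> e x b}"
  using good by (auto simp: good_rank_def)

lemma underS_trans: "a \<in> underS r b \<Longrightarrow> b \<in> underS r c \<Longrightarrow> a \<in> underS r c"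
  using wo unfolding well_order_on_def linear_order_on_def partial_order_on_def preorder_on_def
    underS_def by (auto dest: transD antisymD)

lemma not_underS_self: "a \<notin> underS r a"
  by (simp add: underS_def)

lemma finite_max:
  assumes "finite G" "G \<noteq> {}" "G \<subseteq> I"
  obtains m where "m \<in> G" "G - {m} \<subseteq> underS r m"
proof -
  have "\<exists>m\<in>G. G - {m} \<subseteq> underS r m"
    using assms
  proof (induction rule: finite_ne_induct)
    case (singleton x)
    then show ?case by simp
  next
    case (insert x F)
    then obtain m where m: "m \<in> F" "F - {m} \<subseteq> underS r m" by auto
    have "x \<in> Field r" "m \<in> Field r" "x \<noteq> m" using insert m I_Field by auto
    then consider "x \<in> underS r m" | "m \<in> underS r x"
      using wo unfolding well_order_on_def linear_order_on_def total_on_def underS_def by blast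
    then show ?case
    proof cases
      case 1
      then show ?thesis using m by auto
    next
      case 2
      then have "insert x F - {x} \<subseteq> underS r x" using m underS_trans by blast
      then show ?thesis by blast
    qed
  qed
  then show thesis using that by blast
qed

text \<open>At \<open>x\<close> itself the set contains every point ranked up to \<open>b\<close>.
  At a lower \<open>y\<close> the point \<open>x\<close> cannot occur as \<open>c\<close>, so
  closedness of the segment suffices.\<close>

lemma insert_segment_closed:
  assumes "x \<in> I" "b \<in> underS r x"
  shows "rank_closed r e (insert x {a\<in>underS r x. e x a \<le> e x b})"
  unfolding rank_closed_def
proof (intro ballI impI)
  let ?D = "{a\<in>underS r x. e x a \<le> e x b}"
  fix y c a
  assume y: "y \<in> insert x ?D" and c: "c \<in> insert x ?D \<inter> underS r y"
    and a: "a \<in> underS r y" and lt: "e y a < e y c"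
  show "a \<in> insert x ?D"
  proof (cases "y = x")
    case True
    then show ?thesis using c a lt not_underS_self by auto
  next
    case False
    then have yD: "y \<in> ?D" using y by blast
    then have "c \<noteq> x" using c underS_trans[of x y x] not_underS_self by blast
    then have "c \<in> ?D" using c by blast
    then show ?thesis using rank_closedD[OF closed_segment[OF assms] yD] c a lt by blast
  qed
qed

lemma finite_segment:
  assumes "x \<in> I"
  shows "finite {a\<in>underS r x. e x a \<le> n}"
proof (rule inj_on_finite)
  show "inj_on (e x) {a\<in>underS r x. e x a \<le> n}"
    using inj_rank[OF assms] by (auto simp: inj_on_def)
  show "e x ` {a\<in>underS r x. e x a \<le> n} \<subseteq> {..n}" by auto
qed simp

text \<open>The other points of \<open>A\<close> lie below its maximum \<open>m\<close>, so the
  segment at \<open>m\<close> up to the one ranked highest captures them all.\<close>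

lemma finite_closed_superset:
  assumes "finite A" "A \<subseteq> I" and down: "\<And>x. x \<in> I \<Longrightarrow> underS r x \<subseteq> I"
  obtains G where "finite G" "G \<subseteq> I" "A \<subseteq> G" "rank_closed r e G"
proof (cases "A = {}")
  case True
  then show thesis using that[of "{}"] by (simp add: rank_closed_def)
next
  case False
  then obtain m where m: "m \<in> A" "A - {m} \<subseteq> underS r m"
    using finite_max assms by blast
  then have mI: "m \<in> I" using assms by auto
  show thesis
  proof (cases "A = {m}")
    case True
    then show thesis using that[of "{m}"] mI by (auto simp: rank_closed_def underS_def)
  next
    case False
    then have "A - {m} \<noteq> {}" "finite (A - {m})" using m assms by auto
    then obtain b where b: "b \<in> A - {m}" "\<And>a. a \<in> A - {m} \<Longrightarrow> e m a \<le> e m b"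
      using finite_obtain_max[of "A - {m}" "e m"] by blast
    show thesis
    proof (rule that[of "insert m {a\<in>underS r m. e m a \<le> e m b}"])
      show "finite (insert m {a\<in>underS r m. e m a \<le> e m b})"
        using finite_segment[OF mI] by simp
      show "insert m {a\<in>underS r m. e m a \<le> e m b} \<subseteq> I" using mI down by blast
      show "A \<subseteq> insert m {a\<in>underS r m. e m a \<le> e m b}" using m b by blast
      show "rank_closed r e (insert m {a\<in>underS r m. e m a \<le> e m b})"
        using insert_segment_closed mI b m by blast
    qed
  qed
qed

lemma closed_remove_point:
  assumes G: "finite G" "G \<subseteq> I" "rank_closed r e G" and F: "F \<subset> G" "rank_closed r e F"
  obtains a where "a \<in> G - F" "rank_closed r e (G - {a})"
proof -
  obtain m where m: "m \<in> G" "G - {m} \<subseteq> underS r m"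
    using finite_max G F by blast
  show thesis
  proof (cases "m \<in> F")
    case False
    \<comment> \<open>The maximum is below no point of \<open>G\<close>, so closedness never forces
      it in.\<close>
    have "rank_closed r e (G - {m})"
      using G(3) m underS_trans not_underS_self unfolding rank_closed_def by blast
    then show thesis using that[of m] m False by blast
  next
    case True
    have "finite (G - F)" "G - F \<noteq> {}" using G F by auto
    \<comment> \<open>Maximising over \<open>G - F\<close> guarantees that \<open>a\<close> lies
      outside \<open>F\<close>; the next claim shows that \<open>a\<close> is nevertheless last in
      all of \<open>G - {m}\<close>.\<close>
    then obtain a where a: "a \<in> G - F" "\<And>c. c \<in> G - F \<Longrightarrow> e m c \<le> e m a"
      using finite_obtain_max[of "G - F" "e m"] by blast
    have am: "a \<in> underS r m" using a m True by blast
    have mI: "m \<in> I" using m G by blast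
    have less: "e m c < e m a" if c: "c \<in> G - {m}" "c \<noteq> a" for c
    proof (rule ccontr)
      assume *: "\<not> e m c < e m a"
      have cm: "c \<in> underS r m" using c m by blast
      \<comment> \<open>A point ranked after \<open>a\<close> would lie in \<open>F\<close> by
        maximality; as \<open>m\<close> is in \<open>F\<close> too, closedness of \<open>F\<close>
        would pull \<open>a\<close> into \<open>F\<close>.\<close>
      have "e m c \<noteq> e m a" using inj_rank[OF mI] cm am c by (auto simp: inj_on_def)
      with * have "e m a < e m c" by simp
      moreover from this have "c \<in> F" using a(2)[of c] c by force
      ultimately have "a \<in> F" using rank_closedD[OF F(2) True] cm am by blast
      then show False using a by blast
    qed
    have "rank_closed r e (G - {a})"
      unfolding rank_closed_def
    proof (intro ballI impI)
      fix y c d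
      assume y: "y \<in> G - {a}" and c: "c \<in> (G - {a}) \<inter> underS r y" and d: "d \<in> underS r y"
        and lt: "e y d < e y c"
      have "d \<in> G" using rank_closedD[OF G(3)] y c d lt by blast
      moreover have "d \<noteq> a"
      proof (cases "y = m")
        case True
        then show ?thesis using less[of c] c lt not_underS_self by force
      next
        case False
        then have ym: "y \<in> underS r m" using y m by blast
        have cm: "c \<in> underS r m" using c ym underS_trans by blast
        \<comment> \<open>With \<open>w\<close> the later of \<open>y\<close> and \<open>c\<close>
          at \<open>m\<close>, the segment up to \<open>w\<close> is closed and contains both, hence
          \<open>d\<close>; but \<open>a\<close> comes after \<open>w\<close>.\<close>
        obtain w where w: "w \<in> {y, c}" "e m y \<le> e m w" "e m c \<le> e m w"
          by (metis insertCI nle_le)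
        have wm: "w \<in> underS r m" using w ym cm by blast
        have "w \<in> G - {m}" "w \<noteq> a" using w y c False cm not_underS_self by auto
        then have "e m w < e m a" using less by blast
        moreover have "d \<in> {a\<in>underS r m. e m a \<le> e m w}"
          by (rule rank_closedD[OF closed_segment[OF mI wm], of y c]) (use w c d ym cm lt in auto)
        ultimately show ?thesis by auto
      qed
      ultimately show "d \<in> G - {a}" by blast
    qed
    then show thesis using that a by blast
  qed
qed

text \<open>The enumeration is found backwards: a removable point of \<open>G\<close> outside
  \<open>set xs\<close> becomes the last entry, and induction enumerates the rest.\<close>

lemma closed_prefixes_extend:
  assumes "finite G" "G \<subseteq> I" "rank_closed r e G" "set xs \<subseteq> G" "closed_prefixes r e xs"
  shows "\<exists>ys. set (xs @ ys) = G \<and> closed_prefixes r e (xs @ ys)"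
  using assms(1-4)
proof (induction G rule: finite_psubset_induct)
  case (psubset G)
  show ?case
  proof (cases "set xs = G")
    case True
    then show ?thesis using assms(5) by (intro exI[of _ "[]"]) simp
  next
    case False
    have "rank_closed r e (set (take (length xs) xs))"
      using assms(5) unfolding closed_prefixes_def by blast
    then obtain a where a: "a \<in> G - set xs" "rank_closed r e (G - {a})"
      using closed_remove_point[of G "set xs"] psubset False by auto
    then obtain ys where ys: "set (xs @ ys) = G - {a}" "closed_prefixes r e (xs @ ys)"
      using psubset.IH[of "G - {a}"] psubset.prems by blast
    have G: "set ((xs @ ys) @ [a]) = G" using ys a by auto
    then have "closed_prefixes r e ((xs @ ys) @ [a])"
      using closed_prefixes_snoc[OF ys(2)] psubset.prems by simp
    then show ?thesis using G by (intro exI[of _ "ys @ [a]"]) simp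
  qed
qed

end

section \<open>Ranking the predecessors of a point, and recursion\<close>

text \<open>
  The stages \<open>F n\<close> grow by at most one point at a time, so that the index of the first stage
  containing a point is an injective rank.
\<close>

lemma good_rank_of_stages:
  assumes F0: "F 0 = {}" and mono: "\<And>n. F n \<subseteq> F (Suc n)"
    and one: "\<And>n a b. a \<in> F (Suc n) - F n \<Longrightarrow> b \<in> F (Suc n) - F n \<Longrightarrow> a = b"
    and closed: "\<And>n. rank_closed r e (F n)" and cover: "(\<Union>n. F n) = underS r x"
  shows "good_rank r e x (\<lambda>a. LEAST n. a \<in> F n)"
proof -
  define f where "f a = (LEAST n. a \<in> F n)" for a
  have F_mono: "F m \<subseteq> F n" if "m \<le> n" for m n
    using lift_Suc_mono_le[of F] mono that by blast
  have mem: "a \<in> F n \<longleftrightarrow> f a \<le> n" if "a \<in> underS r x" for a n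
  proof
    show "f a \<le> n" if "a \<in> F n" using that unfolding f_def by (rule Least_le)
    obtain k where "a \<in> F k" using \<open>a \<in> underS r x\<close> cover by blast
    then have "a \<in> F (f a)" unfolding f_def by (rule LeastI)
    then show "a \<in> F n" if "f a \<le> n" using F_mono that by blast
  qed
  have "inj_on f (underS r x)"
  proof (rule inj_onI)
    fix a b assume a: "a \<in> underS r x" and b: "b \<in> underS r x" and eq: "f a = f b"
    \<comment> \<open>Since stage 0 is empty, a common rank is some \<open>Suc n\<close>, and both
      points are new at that stage.\<close>
    have "f a \<noteq> 0" using mem[OF a, of 0] F0 by auto
    then obtain n where "f a = Suc n" using not0_implies_Suc by blast
    then show "a = b" using one[of a n b] mem[OF a] mem[OF b] eq by auto
  qed
  moreover have "{a\<in>underS r x. f a \<le> f b} = F (f b)" if "b \<in> underS r x" for b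
    using mem cover by blast
  ultimately show ?thesis
    using closed unfolding good_rank_def f_def by simp
qed

text \<open>Countability allows successive finite lists, each prolonging the previous one through
  closed prefixes, with the k-th predecessor caught at step k.\<close>

lemma good_rank_step:
  assumes wo: "Well_order r" and countable: "countable (underS r x)"
    and good: "\<And>y. y \<in> underS r x \<Longrightarrow> good_rank r e y (e y)"
  shows "\<exists>f. good_rank r e x f"
proof (cases "underS r x = {}")
  case True
  then show ?thesis by (auto simp: good_rank_def)
next
  case False
  interpret ranking r e "underS r x"
    using wo good by unfold_locales (auto simp: underS_def Field_def)
  define p where "p = from_nat_into (underS r x)"
  have p_range: "range p = underS r x"
    using False countable unfolding p_def by (rule range_from_nat_into)
  define Q where "Q xs \<longleftrightarrow> closed_prefixes r e xs \<and> set xs \<subseteq> underS r x" for xs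
  have "\<exists>zs. Q (xs @ zs) \<and> p k \<in> set (xs @ zs)" if Q: "Q xs" for xs k
  proof -
    have "insert (p k) (set xs) \<subseteq> underS r x" using Q p_range unfolding Q_def by blast
    moreover have "underS r y \<subseteq> underS r x" if "y \<in> underS r x" for y
      using underS_trans that by blast
    ultimately obtain G where G: "finite G" "G \<subseteq> underS r x" "insert (p k) (set xs) \<subseteq> G"
      "rank_closed r e G"
      by (rule finite_closed_superset[rotated]) auto
    then obtain ys where "set (xs @ ys) = G" "closed_prefixes r e (xs @ ys)"
      using closed_prefixes_extend[of G xs] Q unfolding Q_def by blast
    then show ?thesis using G unfolding Q_def by (intro exI[of _ ys]) auto
  qed
  then have step: "\<exists>ys. Q ys \<and> (\<exists>zs. ys = xs @ zs) \<and> p k \<in> set ys" if "Q xs" for xs k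
    using that by blast
  have "Q []" by (simp add: Q_def closed_prefixes_def rank_closed_def)
  then have "\<exists>L. \<forall>k. Q (L k) \<and> (\<exists>zs. L (Suc k) = L k @ zs) \<and> p k \<in> set (L (Suc k))"
    using dependent_nat_choice[of "\<lambda>_. Q" "\<lambda>k xs ys. (\<exists>zs. ys = xs @ zs) \<and> p k \<in> set ys"] step
    by blast
  then obtain L where Q: "\<And>k. Q (L k)" and ext: "\<And>k. \<exists>zs. L (Suc k) = L k @ zs"
    and pL: "\<And>k. p k \<in> set (L (Suc k))"
    by blast
  have prefix: "\<exists>zs. L k = L j @ zs" if "j \<le> k" for j k
    using that
  proof (induction k rule: dec_induct)
    case base
    then show ?case by simp
  next
    case (step k)
    then show ?case using ext[of k] by (metis append_assoc)
  qed
  have take_mono: "set (take n (L j)) \<subseteq> set (take n (L k))" if "j \<le> k" for j k n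
    using prefix[OF that] by auto
  \<comment> \<open>These are the first \<open>n\<close> entries of the limit of the lists. The
    union over \<open>k\<close> is taken because early lists may be shorter than \<open>n\<close>,
    and the limit may be finite.\<close>
  define F where "F n = (\<Union>k. set (take n (L k)))" for n
  \<comment> \<open>Any two points of a stage appear in one list, so properties of finite prefixes
    pass to the stages.\<close>
  have common: "\<exists>k. a \<in> set (take n (L k)) \<and> b \<in> set (take n (L k))"
    if a: "a \<in> F n" and b: "b \<in> F n" for a b n
  proof -
    obtain i j where ij: "a \<in> set (take n (L i))" "b \<in> set (take n (L j))"
      using a b unfolding F_def by blast
    then show ?thesis
      using take_mono[of i "max i j" n] take_mono[of j "max i j" n] by (intro exI[of _ "max i j"]) auto
  qed
  have "good_rank r e x (\<lambda>a. LEAST n. a \<in> F n)"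
  proof (rule good_rank_of_stages)
    show "F 0 = {}" by (simp add: F_def)
    show "F n \<subseteq> F (Suc n)" for n
      unfolding F_def using set_take_subset_set_take[of n "Suc n"] by force
    show "a = b" if a: "a \<in> F (Suc n) - F n" and b: "b \<in> F (Suc n) - F n" for n a b
    proof -
      obtain k where k: "a \<in> set (take (Suc n) (L k))" "b \<in> set (take (Suc n) (L k))"
        using common a b by blast
      have "a \<notin> set (take n (L k))" "b \<notin> set (take n (L k))" using a b by (auto simp: F_def)
      with k show ?thesis
        by (cases "n < length (L k)") (auto simp: take_Suc_conv_app_nth)
    qed
    show "rank_closed r e (F n)" for n
      unfolding rank_closed_def
    proof (intro ballI impI)
      fix y c a
      assume y: "y \<in> F n" and c: "c \<in> F n \<inter> underS r y" and a: "a \<in> underS r y"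
        and lt: "e y a < e y c"
      obtain k where k: "y \<in> set (take n (L k))" "c \<in> set (take n (L k))"
        using common y c by blast
      have "rank_closed r e (set (take n (L k)))"
        using Q unfolding Q_def closed_prefixes_def by blast
      then have "a \<in> set (take n (L k))" by (rule rank_closedD) (use k c a lt in auto)
      then show "a \<in> F n" by (auto simp: F_def)
    qed
    show "(\<Union>n. F n) = underS r x"
    proof
      show "(\<Union>n. F n) \<subseteq> underS r x"
        using Q unfolding F_def Q_def by (blast dest: in_set_takeD)
      show "underS r x \<subseteq> (\<Union>n. F n)"
      proof
        fix a assume "a \<in> underS r x"
        then obtain k where "a = p k" using p_range by blast
        then have "a \<in> set (take (length (L (Suc k))) (L (Suc k)))" using pL by simp
        then show "a \<in> (\<Union>n. F n)" unfolding F_def by blast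
      qed
    qed
  qed
  then show ?thesis by blast
qed

text \<open>Well-founded recursion with choice: \<open>good_rank_cong\<close> gives the required
  dependence on earlier values only. Guarding by \<open>Field r\<close> leaves the ranks elsewhere
  arbitrary.\<close>

lemma good_ranking_exists:
  assumes wo: "Well_order r" and countable: "\<And>x. x \<in> Field r \<Longrightarrow> countable (underS r x)"
  shows "\<exists>e. \<forall>x\<in>Field r. good_rank r e x (e x)"
proof -
  have wf: "wf (r - Id)" using wo unfolding well_order_on_def by blast
  have mem: "(y, x) \<in> r - Id \<longleftrightarrow> y \<in> underS r x" for y x by (auto simp: underS_def)
  have "\<exists>e. \<forall>x. x \<in> Field r \<longrightarrow> good_rank r e x (e x)"
  proof (rule dependent_wf_choice[OF wf])
    show "(x \<in> Field r \<longrightarrow> good_rank r f x h) = (x \<in> Field r \<longrightarrow> good_rank r g x h)"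
      if "\<And>z. (z, x) \<in> r - Id \<Longrightarrow> f z = g z" for f g x h
      using good_rank_cong[of r x f g] that unfolding mem by blast
    show "\<exists>h. x \<in> Field r \<longrightarrow> good_rank r e x h"
      if "\<And>y. (y, x) \<in> r - Id \<Longrightarrow> y \<in> Field r \<longrightarrow> good_rank r e y (e y)" for x e
    proof (cases "x \<in> Field r")
      case True
      have "y \<in> Field r" if "y \<in> underS r x" for y using that by (auto simp: underS_def Field_def)
      then show ?thesis
        using good_rank_step[OF wo countable[OF True], of e] that unfolding mem by blast
    qed simp
  qed
  then show ?thesis by blast
qed

section \<open>Orders induced by injective ranks\<close>

definition rank_order :: "'a set \<Rightarrow> ('a \<Rightarrow> nat) \<Rightarrow> 'a rel" where
  "rank_order A f = {(a, b). a \<in> A \<and> b \<in> A \<and> f a \<le> f b}"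

lemma Field_rank_order: "Field (rank_order A f) = A"
  by (auto simp: rank_order_def Field_def)

lemma rank_order_diff_Id:
  assumes "inj_on f A"
  shows "(a, b) \<in> rank_order A f - Id \<longleftrightarrow> a \<in> A \<and> b \<in> A \<and> f a < f b"
  using assms by (auto simp: rank_order_def inj_on_def order.order_iff_strict)

lemma well_order_on_rank_order:
  assumes "inj_on f A"
  shows "well_order_on A (rank_order A f)"
proof -
  have "rank_order A f - Id \<subseteq> measure f"
    using rank_order_diff_Id[OF assms] by (intro subrelI) (simp only: in_measure)
  then have "wf (rank_order A f - Id)" by (rule wf_subset[OF wf_measure])
  then show ?thesis
    using assms
    unfolding well_order_on_def linear_order_on_def partial_order_on_def preorder_on_def
      refl_on_def trans_def antisym_def total_on_def
    by (auto simp: rank_order_def inj_on_def)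
qed

text \<open>Otherwise \<open>natLeq\<close> would be isomorphic to a proper initial segment; these
  are finite, since injectivity leaves only finitely many points of rank at most
  \<open>f a\<close>.\<close>

lemma rank_order_ordLeq_natLeq:
  assumes "inj_on f A"
  shows "rank_order A f \<le>o natLeq"
proof -
  have wo: "Well_order (rank_order A f)"
    using well_order_on_rank_order[OF assms] Field_rank_order by metis
  show ?thesis
  proof (rule ccontr)
    assume "\<not> rank_order A f \<le>o natLeq"
    then have "natLeq <o rank_order A f"
      using ordLess_or_ordLeq[OF natLeq_Well_order wo] by blast
    then obtain a where "natLeq =o Restr (rank_order A f) (underS (rank_order A f) a)"
      using ordLess_iff_ordIso_Restr[OF wo natLeq_Well_order] by blast
    then obtain g where
      "bij_betw g (Field natLeq) (Field (Restr (rank_order A f) (underS (rank_order A f) a)))"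
      unfolding ordIso_def iso_def by blast
    then have "infinite (Field (Restr (rank_order A f) (underS (rank_order A f) a)))"
      using bij_betw_finite Field_natLeq infinite_UNIV_nat by metis
    moreover have "Field (Restr (rank_order A f) (underS (rank_order A f) a)) \<subseteq> {b\<in>A. f b \<le> f a}"
      by (auto simp: Field_def underS_def rank_order_def)
    moreover have "finite {b\<in>A. f b \<le> f a}"
      using assms by (intro inj_on_finite[of f _ "{..f a}"]) (auto simp: inj_on_def)
    ultimately show False using finite_subset by blast
  qed
qed

section \<open>The system on \<open>omega1\<close>\<close>

lemma countable_underS_omega1:
  assumes "x \<in> Field omega1"
  shows "countable (underS omega1 x)"
proof -
  have "Card_order omega1"
    unfolding omega1_def by (rule cardSuc_Card_order[OF natLeq_Card_order])
  then have "|underS omega1 x| <o cardSuc natLeq"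
    using card_of_underS[OF _ assms] by (simp add: omega1_def)
  then have "|underS omega1 x| \<le>o natLeq"
    using cardSuc_ordLeq_ordLess[OF natLeq_Card_order card_of_Card_order] by blast
  then have "|underS omega1 x| \<le>o |UNIV :: nat set|"
    by (rule ordLeq_ordIso_trans[OF _ ordIso_symmetric[OF card_of_nat]])
  then show ?thesis
    unfolding countable_def card_of_ordLeq[symmetric] by simp
qed

theorem theorem3p1:
  shows "\<exists>R :: nat set set \<Rightarrow> nat set rel.
    ordering_system 2 (Field omega1) R \<and>
    order_type_bounded2 (Field omega1) R omega1 natLeq \<and>
    (\<forall>S. closed_initial_segment2 (Field omega1) R S \<longrightarrow> os_closed 2 (Field omega1) R S) \<and>
    finite_closures 2 (Field omega1) R"
proof -
  let ?X = "Field omega1"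
  have wo: "Well_order omega1"
    unfolding omega1_def
    using cardSuc_Card_order[OF natLeq_Card_order] card_order_on_well_order_on by blast
  obtain e where e: "\<And>x. x \<in> ?X \<Longrightarrow> good_rank omega1 e x (e x)"
    using good_ranking_exists[OF wo countable_underS_omega1] by blast
  interpret ranking omega1 e ?X
    using wo e by unfold_locales auto
  \<comment> \<open>For n = 2 only the empty set and singletons matter; \<open>the_elem\<close>
    recovers \<open>x\<close> from \<open>{x}\<close>, and other values are junk.\<close>
  define R where
    "R s = (if s = {} then omega1 else rank_order (underS omega1 (the_elem s)) (e (the_elem s)))"
    for s
  have R0: "R {} = omega1" and R1: "R {x} = rank_order (underS omega1 x) (e x)" for x
    by (simp_all add: R_def)
  have sub: "underS omega1 x \<subseteq> ?X" for x by (auto simp: underS_def Field_def)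
  have pred: "{y \<in> ?X. (y, x) \<in> omega1 - Id} = underS omega1 x" for x
    by (auto simp: underS_def Field_def)
  have dom: "rel_dom ?X (R {x}) = underS omega1 x" for x
    using sub by (auto simp: rel_dom_def R1 rank_order_def)
  have less: "(a, b) \<in> R {x} - Id \<longleftrightarrow> a \<in> underS omega1 x \<and> b \<in> underS omega1 x \<and> e x a < e x b"
    if "x \<in> ?X" for x a b
    unfolding R1 by (rule rank_order_diff_Id[OF inj_rank[OF that]])
  have closed: "os_closed 2 ?X R S" if "rank_closed omega1 e S" "S \<subseteq> ?X" for S
    unfolding os_closed_def
  proof (intro conjI allI impI ballI)
    fix s a b
    assume s: "s \<subseteq> S \<and> finite s \<and> card s = 2 - 1"
      and ab: "b \<in> S \<and> (a, b) \<in> R s - Id"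
    then obtain y where y: "s = {y}" by (auto simp: card_1_singleton_iff)
    then have "y \<in> S" using s by blast
    then show "a \<in> S"
      using rank_closedD[OF that(1) \<open>y \<in> S\<close>, of b a] less[of y a b] ab y that(2) by blast
  qed (rule that(2))
  have "ordering_system 2 ?X R"
    using wo well_order_on_rank_order[OF inj_rank]
    by (simp add: numeral_2_eq_2 R0 R1 pred[simplified])
  moreover have "order_type_bounded2 ?X R omega1 natLeq"
    using wo rank_order_ordLeq_natLeq[OF inj_rank]
    by (simp add: order_type_bounded2_def R0 R1 ordLeq_reflexive)
  moreover have "os_closed 2 ?X R S" if S_segment: "closed_initial_segment2 ?X R S" for S
  proof -
    obtain x b where x: "x \<in> ?X" and b: "b \<in> underS omega1 x"
      and S: "S = {x, b} \<union> {a. (a, b) \<in> R {x} - Id}"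
      using S_segment unfolding closed_initial_segment2_def dom by blast
    \<comment> \<open>The explicit \<open>b\<close> restores the endpoint lost to strictness; by
      injectivity no other point has its rank.\<close>
    have "S = insert x {a \<in> underS omega1 x. e x a \<le> e x b}"
      unfolding S less[OF x] using b inj_rank[OF x]
      by (auto simp: inj_on_def order.order_iff_strict)
    then show ?thesis
      using closed[of S] insert_segment_closed[OF x b] x sub by blast
  qed
  moreover have "finite_closures 2 ?X R"
    unfolding finite_closures_def
  proof (intro allI impI)
    fix A assume A: "finite A \<and> A \<subseteq> ?X"
    obtain G where "finite G" "G \<subseteq> ?X" "A \<subseteq> G" "rank_closed omega1 e G"
      using finite_closed_superset[of A] A sub by blast
    then show "\<exists>S. finite S \<and> os_closed 2 ?X R S \<and> A \<subseteq> S" using closed by blast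
  qed
  ultimately show ?thesis by blast
qed

end
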